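(* Let $A$ be an $m \times n$ matrix with complex entries. If $A$ is a $(q,k,t)$-design matrix with $k \leq nt$, then $$\operatorname{rank}(A) \;\geq\; n - \frac{6n^3t^3}{k^3}.$$
   Context: For a vector $v \in \mathbb{C}^N$, $\operatorname{supp}(v) = \{i : v_i \neq 0\}$. Let $A$ be an $m\times n$ matrix over $\mathbb{C}$ with rows $R_1,\dots,R_m \in \mathbb{C}^n$ and columns $C_1,\dots,C_n \in \mathbb{C}^m$. $A$ is a $(q,k,t)$-design matrix (with $q,k$ positive integers and $t$ a nonnegative integer) if: (1) $|\operatorname{supp}(R_i)| \le q$ for all $i \in [m]$; (2) $|\operatorname{supp}(C_j)| \ge k$ for all $j \in [n]$; (3) $|\operatorname{supp}(C_{j_1}) \cap \operatorname{supp}(C_{j_2})| \le t$ for all $j_1 \ne j_2 \in [n]$. *)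

theory Defs
  imports "HOL-Analysis.Analysis"
begin

definition supp :: "complex ^ 'N \<Rightarrow> 'N set" where
  "supp v = {i. v $ i \<noteq> 0}"

text \<open>An element of type \<open>complex ^ 'n ^ 'm\<close> has rows indexed by \<open>'m\<close> and columns indexed by
  \<open>'n\<close>.\<close>

definition design_matrix :: "nat \<Rightarrow> nat \<Rightarrow> nat \<Rightarrow> complex ^ 'n ^ 'm \<Rightarrow> bool" where
  "design_matrix q k t A \<longleftrightarrow>
     q > 0 \<and> k > 0 \<and>
     (\<forall>i. card (supp (row i A)) \<le> q) \<and>
     (\<forall>j. card (supp (column j A)) \<ge> k) \<and>
     (\<forall>j1 j2. j1 \<noteq> j2 \<longrightarrow> card (supp (column j1 A) \<inter> supp (column j2 A)) \<le> t)"

end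

theory Submission
  imports Defs
begin

text \<open>
  Rescaling the rows and columns of \<open>A\<close> does not change its rank, and if \<open>B\<close> is a rescaling whose
  Gram matrix \<open>B\<^sup>* B\<close> is close to the identity, then its kernel is small: an orthonormal basis of the
  kernel is fixed up to sign by \<open>E = B\<^sup>* B - 1\<close>, so Bessel's inequality bounds the dimension of the
  kernel by \<open>\<parallel>E\<parallel>\<^sup>2\<close> (Frobenius norm).

  To find \<open>B\<close>, put the weight \<open>1 / |supp C\<^sub>j|\<close> on each nonzero entry of column \<open>j\<close>, and let \<open>w\<^sub>i\<close> be
  the total weight of row \<open>i\<close>. A convex function bounded below has almost critical points, and this gives
  a column scaling after which the rows of \<open>|B\<^sub>i\<^sub>j|\<^sup>2\<close> sum to \<open>w\<^sub>i\<close> and its columns almost sum to 1.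
  The overlap condition together with Cauchy--Schwarz bounds the off-diagonal part of \<open>E\<close>. Since
  \<open>w\<^sub>i \<le> |supp R\<^sub>i| / k\<close>, rows of large support need no separate treatment; double counting gives
  \<open>\<parallel>E\<parallel>\<^sup>2 \<le> (n t / k)\<^sup>2\<close>, which is at most \<open>(n t / k)\<^sup>3\<close> when \<open>k \<le> n t\<close>.
\<close>

section \<open>Linear algebra: rank and distance to the identity\<close>

lemma inner_cnj:
  fixes c :: "'n::finite \<Rightarrow> complex"
  shows "inner (\<chi> l. cnj (c l)) x = Re (\<Sum>l\<in>UNIV. c l * x $ l)"
    and "inner (\<chi> l. \<i> * cnj (c l)) x = Im (\<Sum>l\<in>UNIV. c l * x $ l)"
  by (simp_all add: inner_vec_def inner_complex_def algebra_simps)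

lemma Bessel_inequality:
  fixes B :: "'a::real_inner set"
  assumes "finite B" "pairwise orthogonal B" "\<And>b. b \<in> B \<Longrightarrow> norm b = 1"
  shows "(\<Sum>b\<in>B. (inner x b)\<^sup>2) \<le> (norm x)\<^sup>2"
proof -
  define p where "p = (\<Sum>b\<in>B. inner x b *\<^sub>R b)"
  have bb: "inner b c = (if b = c then 1 else 0)" if "b \<in> B" "c \<in> B" for b c
    using that assms(2,3) by (auto simp: pairwise_def orthogonal_def dot_square_norm)
  have "inner p p = (\<Sum>b\<in>B. \<Sum>c\<in>B. inner x b * inner x c * inner b c)"
    by (simp add: p_def inner_sum_left inner_sum_right mult_ac sum_distrib_left inner_commute)
  also have "\<dots> = (\<Sum>b\<in>B. \<Sum>c\<in>B. if b = c then (inner x b)\<^sup>2 else 0)"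
    by (intro sum.cong refl) (simp add: bb power2_eq_square)
  finally have pp: "inner p p = (\<Sum>b\<in>B. (inner x b)\<^sup>2)"
    using assms(1) by simp
  have xp: "inner x p = (\<Sum>b\<in>B. (inner x b)\<^sup>2)"
    by (simp add: p_def inner_sum_right power2_eq_square)
  have "0 \<le> inner (x - p) (x - p)" by simp
  also have "\<dots> = (norm x)\<^sup>2 - (\<Sum>b\<in>B. (inner x b)\<^sup>2)"
    using pp xp unfolding power2_norm_eq_inner
    by (simp only: inner_diff_left inner_diff_right inner_commute[of p x])
  finally show ?thesis by simp
qed

text \<open>Lets the kernel be tested on a basis of the row space, so that the number of equations
  is the rank and not the number of rows.\<close>

lemma row_in_span_mult_eq_0:
  fixes A :: "complex ^ 'n ^ 'm"
  assumes R: "rows A \<subseteq> vec.span R" and x: "\<And>b. b \<in> R \<Longrightarrow> (\<Sum>j\<in>UNIV. b $ j * x $ j) = 0"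
  shows "A *v x = 0"
proof -
  have 1: "(\<Sum>j\<in>UNIV. b $ j * x $ j) = 0" if "b \<in> vec.span R" for b
    using that
  proof (induction rule: vec.span_induct_alt)
    case base
    show ?case by simp
  next
    case (step c b y)
    have "(\<Sum>j\<in>UNIV. (c *s b + y) $ j * x $ j)
        = c * (\<Sum>j\<in>UNIV. b $ j * x $ j) + (\<Sum>j\<in>UNIV. y $ j * x $ j)"
      by (simp add: algebra_simps sum.distrib sum_distrib_left)
    then show ?case using step x by simp
  qed
  have "(\<Sum>j\<in>UNIV. row i A $ j * x $ j) = 0" for i
    using R by (intro 1) (auto simp: rows_def)
  then show ?thesis
    by (simp add: vec_eq_iff matrix_vector_mult_def row_def)
qed

text \<open>Orthonormal bases exist in the library only for real inner products, hence the kernel is measured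
  as a real subspace, of twice the complex dimension.\<close>

lemma real_dim_kernel_ge:
  fixes A :: "complex ^ 'n ^ 'm" and D :: "complex ^ 'p ^ 'n"
  shows "2 * CARD('p) \<le> dim {x. A *v (D *v x) = 0} + 2 * rank A"
proof -
  obtain R where R: "R \<subseteq> rows A" "vec.independent R" "rows A \<subseteq> vec.span R" "card R = rank A"
    using vec.basis_exists[of "rows A"] by (auto simp: row_rank_def_gen)
  have "finite R"
    using R(2) vec.finiteI_independent by blast
  \<comment> \<open>By \<open>inner_cnj\<close>, the complex equation given by \<open>b\<close>
    amounts to two real orthogonality conditions, one for its real and one for its imaginary part.
    This costs at most \<open>2 * rank A\<close> real vectors.\<close>
  define T where "T = (\<lambda>b. \<chi> l. cnj (\<Sum>j\<in>UNIV. b $ j * D $ j $ l)) ` R \<union>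
     (\<lambda>b. \<chi> l. \<i> * cnj (\<Sum>j\<in>UNIV. b $ j * D $ j $ l)) ` R"
  let ?S = "{y \<in> UNIV. \<forall>x \<in> span T. orthogonal x y}"
  have "dim ?S + dim (span T) = dim (UNIV :: (complex ^ 'p) set)"
    by (rule dim_subspace_orthogonal_to_vectors) auto
  moreover have "dim (span T) \<le> 2 * rank A"
  proof -
    have "dim T \<le> card T"
      using \<open>finite R\<close> by (intro dim_le_card') (simp add: T_def)
    also have "\<dots> \<le> card R + card R"
      unfolding T_def
      by (intro order_trans[OF card_Un_le] add_mono card_image_le \<open>finite R\<close>)
    finally show ?thesis using R(4) by simp
  qed
  moreover have "?S \<subseteq> {x. A *v (D *v x) = 0}"
  proof safe
    fix x assume "\<forall>y\<in>span T. orthogonal y x"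
    then have o: "inner y x = 0" if "y \<in> T" for y
      using that span_base unfolding orthogonal_def by blast
    show "A *v (D *v x) = 0"
    proof (rule row_in_span_mult_eq_0[OF R(3)])
      fix b assume "b \<in> R"
      then have "(\<chi> l. cnj (\<Sum>j\<in>UNIV. b $ j * D $ j $ l)) \<in> T"
        "(\<chi> l. \<i> * cnj (\<Sum>j\<in>UNIV. b $ j * D $ j $ l)) \<in> T"
        by (auto simp: T_def)
      then have "(\<Sum>l\<in>UNIV. (\<Sum>j\<in>UNIV. b $ j * D $ j $ l) * x $ l) = 0"
        using o inner_cnj[of "\<lambda>l. \<Sum>j\<in>UNIV. b $ j * D $ j $ l" x] by (auto simp: complex_eq_iff)
      also have "(\<Sum>l\<in>UNIV. (\<Sum>j\<in>UNIV. b $ j * D $ j $ l) * x $ l)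
          = (\<Sum>j\<in>UNIV. b $ j * (D *v x) $ j)"
        unfolding matrix_vector_mult_def
        by (simp add: sum_distrib_left sum_distrib_right mult_ac) (rule sum.swap)
      finally show "(\<Sum>j\<in>UNIV. b $ j * (D *v x) $ j) = 0" .
    qed
  qed
  then have "dim ?S \<le> dim {x. A *v (D *v x) = 0}"
    by (rule dim_subset)
  ultimately show ?thesis by simp
qed

text \<open>The squared norms of an orthonormal kernel basis add up to its real dimension; they are
  summed coordinate by coordinate. Row \<open>i\<close> of \<open>E\<close> enters Bessel's
  inequality through two real vectors of equal norm, and this factor 2 cancels the one in
  \<open>real_dim_kernel_ge\<close>.\<close>

lemma rank_ge_near_identity:
  fixes A :: "complex ^ 'n ^ 'm" and C :: "complex ^ 'm ^ 'p" and D :: "complex ^ 'p ^ 'n"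
  shows "real CARD('p) - (\<Sum>i\<in>UNIV. \<Sum>j\<in>UNIV. (cmod ((C ** A ** D - mat 1) $ i $ j))\<^sup>2) \<le> rank A"
proof -
  define E where "E = C ** A ** D - mat 1"
  let ?K = "{x. A *v (D *v x) = 0}"
  have "subspace ?K"
    by (auto simp: subspace_def matrix_vector_right_distrib)
       (simp add: matrix_vector_mult_def vec_eq_iff scaleR_sum_right[symmetric])
  then obtain B where B: "B \<subseteq> ?K" "pairwise orthogonal B" "\<And>x. x \<in> B \<Longrightarrow> norm x = 1"
      "independent B" "card B = dim ?K"
    using orthonormal_basis_subspace by metis
  have fin: "finite B"
    using B(4) independent_imp_finite by blast
  have E: "E *v x = - x" if "x \<in> B" for x
    using that B(1) unfolding E_def
    by (auto simp: matrix_vector_mult_diff_rdistrib matrix_vector_mul_assoc[symmetric])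
  have row: "(\<Sum>x\<in>B. (cmod (x $ i))\<^sup>2) \<le> 2 * (\<Sum>j\<in>UNIV. (cmod (E $ i $ j))\<^sup>2)" for i
  proof -
    let ?u = "\<chi> l. cnj (E $ i $ l)" and ?v = "\<chi> l. \<i> * cnj (E $ i $ l)"
    have "(cmod (x $ i))\<^sup>2 = (inner ?u x)\<^sup>2 + (inner ?v x)\<^sup>2" if "x \<in> B" for x
    proof -
      have "cmod (x $ i) = cmod ((E *v x) $ i)" using E[OF that] by simp
      also have "\<dots> = cmod (\<Sum>l\<in>UNIV. E $ i $ l * x $ l)" by (simp add: matrix_vector_mult_def)
      finally show ?thesis by (simp only: inner_cnj cmod_power2)
    qed
    then have "(\<Sum>x\<in>B. (cmod (x $ i))\<^sup>2) = (\<Sum>x\<in>B. (inner ?u x)\<^sup>2) + (\<Sum>x\<in>B. (inner ?v x)\<^sup>2)"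
      by (simp add: sum.distrib)
    also have "\<dots> \<le> (norm ?u)\<^sup>2 + (norm ?v)\<^sup>2"
      using B fin by (intro add_mono Bessel_inequality) auto
    also have "\<dots> = 2 * (\<Sum>j\<in>UNIV. (cmod (E $ i $ j))\<^sup>2)"
      by (simp add: norm_vec_def L2_set_def norm_mult sum_nonneg)
    finally show ?thesis .
  qed
  have "real (card B) = (\<Sum>x\<in>B. (norm x)\<^sup>2)"
    using B(3) by simp
  also have "\<dots> = (\<Sum>x\<in>B. \<Sum>i\<in>UNIV. (cmod (x $ i))\<^sup>2)"
    by (simp add: norm_vec_def L2_set_def sum_nonneg)
  also have "\<dots> = (\<Sum>i\<in>UNIV. \<Sum>x\<in>B. (cmod (x $ i))\<^sup>2)"
    by (rule sum.swap)
  also have "\<dots> \<le> (\<Sum>i\<in>UNIV. 2 * (\<Sum>j\<in>UNIV. (cmod (E $ i $ j))\<^sup>2))"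
    by (intro sum_mono row)
  also have "\<dots> = 2 * (\<Sum>i\<in>UNIV. \<Sum>j\<in>UNIV. (cmod (E $ i $ j))\<^sup>2)"
    by (simp add: sum_distrib_left)
  finally show ?thesis
    using real_dim_kernel_ge[of A D] B(5) unfolding E_def by linarith
qed

section \<open>Approximate matrix scaling\<close>

text \<open>Row scaling is built in through the quotient, so only the column sums need balancing.
  The tolerance is there because the infimum of the potential \<open>F\<close> need not be
  attained.\<close>

lemma approximate_scaling:
  fixes a u :: "'m::finite \<Rightarrow> 'n::finite \<Rightarrow> real"
  assumes a: "\<And>i j. 0 \<le> a i j" and u: "\<And>i j. 0 \<le> u i j"
    and ua: "\<And>i j. u i j \<noteq> 0 \<Longrightarrow> 0 < a i j" and "0 < \<epsilon>"
  obtains x :: "'n \<Rightarrow> real" where "\<And>j. 0 < x j"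
    "\<And>j. \<bar>(\<Sum>i\<in>UNIV. (\<Sum>l\<in>UNIV. u i l) * (a i j * x j / (\<Sum>l\<in>UNIV. a i l * x l))) - (\<Sum>i\<in>UNIV. u i j)\<bar> \<le> \<epsilon>"
proof -
  define s where "s i y = (\<Sum>l\<in>UNIV. a i l * exp (y $ l))" for i and y :: "real ^ 'n"
  \<comment> \<open>With \<open>x j = exp (y $ j)\<close>, the \<open>j\<close>-th partial
    derivative of \<open>F\<close> is exactly the column discrepancy to be bounded.\<close>
  define F where "F y = (\<Sum>i\<in>UNIV. \<Sum>l\<in>UNIV. u i l * (ln (s i y) - y $ l))" for y
  define L where "L = (\<Sum>i\<in>UNIV. \<Sum>l\<in>UNIV. u i l * ln (a i l))"
  have s_ge: "a i l * exp (y $ l) \<le> s i y" for i l y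
    unfolding s_def by (rule member_le_sum) (use a in auto)
  \<comment> \<open>A zero row of \<open>a\<close> makes \<open>s i y\<close> vanish, but then all
    \<open>u i l\<close> of that row are 0. Hence the case splits on \<open>u i l = 0\<close>
    below.\<close>
  have s_pos: "0 < s i y" if "u i l \<noteq> 0" for i l y
    using s_ge[of i l y] ua[OF that] by (meson exp_gt_zero less_le_trans mult_pos_pos)
  have F_ge: "L \<le> F y" for y
    unfolding L_def F_def
  proof (intro sum_mono)
    fix i l
    show "u i l * ln (a i l) \<le> u i l * (ln (s i y) - y $ l)"
    proof (cases "u i l = 0")
      case False
      have "ln (a i l) + y $ l = ln (a i l * exp (y $ l))"
        using ua[OF False] by (simp add: ln_mult)
      also have "\<dots> \<le> ln (s i y)"
        using s_ge ua[OF False] s_pos[OF False] by simp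
      finally show ?thesis
        using u by (intro mult_left_mono) auto
    qed simp
  qed
  have F_cont: "continuous_on UNIV F"
    unfolding F_def
  proof (intro continuous_on_sum)
    fix i l
    show "continuous_on UNIV (\<lambda>y. u i l * (ln (s i y) - y $ l))"
    proof (cases "u i l = 0")
      case False
      have "continuous_on UNIV (s i)"
        unfolding s_def by (intro continuous_intros)
      then show ?thesis
        using s_pos[OF False] by (intro continuous_intros) (auto simp: less_imp_neq[THEN not_sym])
    qed simp
  qed
  define K where "K = F 0 - L"
  have "0 \<le> K" using F_ge by (simp add: K_def)
  \<comment> \<open>At the minimum, \<open>\<eta> * (norm y)\<^sup>2 \<le> K\<close>, so the squared
    gradient entries are at most \<open>4 * \<eta> * K\<close>, which must not exceed
    \<open>\<epsilon>\<^sup>2\<close>. The \<open>+ 1\<close> covers \<open>K = 0\<close>.\<close>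
  define \<eta> where "\<eta> = \<epsilon>\<^sup>2 / (4 * (K + 1))"
  have "0 < \<eta>" using \<open>0 < \<epsilon>\<close> \<open>0 \<le> K\<close> by (simp add: \<eta>_def)
  \<comment> \<open>The penalty makes \<open>G\<close> attain its minimum, where the gradient of \<open>F\<close> is the small vector \<open>- 2 \<eta> y\<close>.\<close>
  define G where "G y = F y + \<eta> * (norm y)\<^sup>2" for y
  have G0: "G 0 = L + K" by (simp add: G_def K_def)
  \<comment> \<open>Outside this ball the penalty alone is at least \<open>K\<close>, so
    \<open>G\<close> is at least \<open>G 0\<close> there, and the minimum over the compact ball is
    global.\<close>
  define r where "r = sqrt (K / \<eta>)"
  have "0 \<le> r" using \<open>0 \<le> K\<close> \<open>0 < \<eta>\<close> by (simp add: r_def)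
  have "continuous_on (cball 0 r) G"
    unfolding G_def using continuous_on_subset[OF F_cont] by (intro continuous_intros) auto
  then obtain y where y: "\<And>z. z \<in> cball 0 r \<Longrightarrow> G y \<le> G z"
    using continuous_attains_inf[of "cball 0 r" G] \<open>0 \<le> r\<close> by force
  have y0: "G y \<le> L + K"
    using y[of 0] \<open>0 \<le> r\<close> by (simp add: G0)
  have y_min: "G y \<le> G z" for z
  proof (cases "norm z \<le> r")
    case False
    then have "r\<^sup>2 \<le> (norm z)\<^sup>2"
      using \<open>0 \<le> r\<close> by (intro power_mono) auto
    then have "K \<le> \<eta> * (norm z)\<^sup>2"
      using \<open>0 < \<eta>\<close> \<open>0 \<le> K\<close> by (simp add: r_def field_simps)
    then show ?thesis
      using y0 F_ge[of z] by (simp add: G_def)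
  qed (use y in simp)
  have y_norm: "\<eta> * (norm y)\<^sup>2 \<le> K"
    using y0 F_ge[of y] by (simp add: G_def)
  have crit: "(\<Sum>i\<in>UNIV. (\<Sum>l\<in>UNIV. u i l) * (a i j * exp (y $ j) / s i y)) - (\<Sum>i\<in>UNIV. u i j)
      = - (2 * \<eta> * y $ j)" for j
  proof -
    define e where "e l = (if l = j then 1 else 0 :: real)" for l
    define z where "z \<tau> = y + \<tau> *\<^sub>R axis j 1" for \<tau>
    have z_nth: "z \<tau> $ l = y $ l + \<tau> * e l" for \<tau> l
      by (simp add: z_def e_def axis_def)
    have z0: "z 0 = y" by (simp add: z_def)
    have e_sum: "(\<Sum>l\<in>UNIV. f l * e l) = f j" for f :: "'n \<Rightarrow> real"
      by (simp add: e_def if_distrib[of "\<lambda>x. _ * x"] cong: if_cong)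
    have ds: "((\<lambda>\<tau>. s i (z \<tau>)) has_field_derivative a i j * exp (y $ j)) (at 0)" for i
    proof -
      have "((\<lambda>\<tau>. s i (z \<tau>)) has_field_derivative (\<Sum>l\<in>UNIV. a i l * exp (y $ l) * e l)) (at 0)"
        unfolding s_def z_nth by (intro DERIV_sum) (auto intro!: derivative_eq_intros)
      then show ?thesis by (simp only: e_sum)
    qed
    have dF: "((\<lambda>\<tau>. F (z \<tau>)) has_field_derivative
        (\<Sum>i\<in>UNIV. \<Sum>l\<in>UNIV. u i l * (a i j * exp (y $ j) / s i y - e l))) (at 0)"
      unfolding F_def
    proof (intro DERIV_sum)
      fix i l
      show "((\<lambda>\<tau>. u i l * (ln (s i (z \<tau>)) - z \<tau> $ l)) has_field_derivative
          u i l * (a i j * exp (y $ j) / s i y - e l)) (at 0)"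
      proof (cases "u i l = 0")
        case False
        have "0 < s i (z 0)" by (rule s_pos[OF False])
        then show ?thesis
          unfolding z_nth
          by (auto intro!: derivative_eq_intros ds simp: z0)
      qed simp
    qed
    have dn: "((\<lambda>\<tau>. (norm (z \<tau>))\<^sup>2) has_field_derivative 2 * y $ j) (at 0)"
    proof -
      have "((\<lambda>\<tau>. \<Sum>l\<in>UNIV. (y $ l + \<tau> * e l)\<^sup>2) has_field_derivative
          (\<Sum>l\<in>UNIV. 2 * y $ l * e l)) (at 0)"
        by (intro DERIV_sum) (auto intro!: derivative_eq_intros)
      then show ?thesis
        by (simp add: norm_vec_def L2_set_def sum_nonneg z_nth e_sum)
    qed
    have "((\<lambda>\<tau>. G (z \<tau>)) has_field_derivative
        (\<Sum>i\<in>UNIV. \<Sum>l\<in>UNIV. u i l * (a i j * exp (y $ j) / s i y - e l)) + \<eta> * (2 * y $ j)) (at 0)"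
      unfolding G_def by (intro derivative_intros dF DERIV_cmult dn)
    then have "(\<Sum>i\<in>UNIV. \<Sum>l\<in>UNIV. u i l * (a i j * exp (y $ j) / s i y - e l)) + \<eta> * (2 * y $ j) = 0"
      by (rule DERIV_local_min[where d = 1]) (use y_min z0 in auto)
    moreover have "(\<Sum>l\<in>UNIV. u i l * (a i j * exp (y $ j) / s i y - e l))
        = (\<Sum>l\<in>UNIV. u i l) * (a i j * exp (y $ j) / s i y) - u i j" for i
      by (simp only: right_diff_distrib sum_subtractf e_sum sum_distrib_right)
    ultimately show ?thesis
      by (simp add: sum_subtractf)
  qed
  have "\<bar>2 * \<eta> * y $ j\<bar> \<le> \<epsilon>" for j
  proof (rule abs_le_square_iff[of _ \<epsilon>, THEN iffD2, THEN order_trans])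
    have "(y $ j)\<^sup>2 \<le> (norm y)\<^sup>2"
      using component_le_norm_cart[of y j] by (simp add: abs_le_square_iff[symmetric])
    then have "(2 * \<eta> * y $ j)\<^sup>2 \<le> 4 * \<eta> * (\<eta> * (norm y)\<^sup>2)"
      using \<open>0 < \<eta>\<close> by (simp add: power_mult_distrib power2_eq_square)
    also have "\<dots> \<le> 4 * \<eta> * K"
      using y_norm \<open>0 < \<eta>\<close> by (intro mult_left_mono) auto
    also have "\<dots> \<le> \<epsilon>\<^sup>2"
      using \<open>0 \<le> K\<close> by (simp add: \<eta>_def field_simps)
    finally show "(2 * \<eta> * y $ j)\<^sup>2 \<le> \<epsilon>\<^sup>2" .
  qed (use \<open>0 < \<epsilon>\<close> in simp)
  then show ?thesis
    using crit by (intro that[of "\<lambda>j. exp (y $ j)"]) (simp_all add: s_def)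
qed

section \<open>Counting overlaps and bounding off-diagonal products\<close>

text \<open>Double counting of the pairs \<open>(i, l)\<close> with \<open>l \<noteq> j\<close> and
  both \<open>I i j\<close> and \<open>I i l\<close>; the \<open>- 1\<close> removes
  \<open>l = j\<close> from each row.\<close>

lemma sum_card_overlap_le:
  fixes I :: "'m::finite \<Rightarrow> 'n::finite \<Rightarrow> bool"
  assumes "\<And>l. l \<noteq> j \<Longrightarrow> card ({i. I i j} \<inter> {i. I i l}) \<le> t"
  shows "(\<Sum>i | I i j. real (card {l. I i l}) - 1) \<le> (real CARD('n) - 1) * real t"
proof -
  have "(\<Sum>i | I i j. real (card {l. I i l}) - 1) = (\<Sum>i | I i j. \<Sum>l\<in>UNIV - {j}. if I i l then 1 else 0)"
  proof (intro sum.cong refl)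
    fix i assume i: "i \<in> {i. I i j}"
    have "real (card {l. I i l}) = (\<Sum>l\<in>UNIV. if I i l then 1 else 0)"
      by (simp add: sum.If_cases)
    also have "\<dots> = 1 + (\<Sum>l\<in>UNIV - {j}. if I i l then 1 else 0)"
      using i by (subst sum.remove[of _ j]) auto
    finally show "real (card {l. I i l}) - 1 = (\<Sum>l\<in>UNIV - {j}. if I i l then 1 else 0)"
      by simp
  qed
  also have "\<dots> = (\<Sum>l\<in>UNIV - {j}. real (card ({i. I i j} \<inter> {i. I i l})))"
    by (subst sum.swap) (simp add: sum.If_cases)
  also have "\<dots> \<le> (\<Sum>l\<in>UNIV - {j}. real t)"
    using assms by (intro sum_mono) auto
  also have "\<dots> = (real CARD('n) - 1) * real t"
    by (simp add: card_Diff_singleton of_nat_diff)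
  finally show ?thesis .
qed

text \<open>The double sum is the square of the total minus the sum of squares, and Cauchy-Schwarz
  on \<open>R\<close> bounds the latter from below. The factor \<open>card R\<close> later absorbs
  the size of a row's support.\<close>

lemma sum_offdiag_prod_le:
  fixes p :: "'n::finite \<Rightarrow> real"
  assumes p: "\<And>j. 0 \<le> p j" "sum p UNIV \<le> 1" and R: "\<And>j. p j \<noteq> 0 \<Longrightarrow> j \<in> R" "R \<noteq> {}"
  shows "real (card R) * (\<Sum>j\<in>UNIV. \<Sum>l\<in>UNIV - {j}. p j * p l) \<le> real (card R) - 1"
proof -
  have "(\<Sum>j\<in>UNIV. \<Sum>l\<in>UNIV - {j}. p j * p l) = (\<Sum>j\<in>UNIV. (\<Sum>l\<in>UNIV. p j * p l) - (p j)\<^sup>2)"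
    by (intro sum.cong refl) (simp add: sum_diff1 power2_eq_square)
  also have "\<dots> = (sum p UNIV)\<^sup>2 - (\<Sum>j\<in>UNIV. (p j)\<^sup>2)"
    by (simp add: sum_subtractf power2_eq_square[of "sum p UNIV"] sum_product)
  finally have eq: "(\<Sum>j\<in>UNIV. \<Sum>l\<in>UNIV - {j}. p j * p l) = (sum p UNIV)\<^sup>2 - (\<Sum>j\<in>UNIV. (p j)\<^sup>2)" .
  have "sum p UNIV = sum p R" "(\<Sum>j\<in>UNIV. (p j)\<^sup>2) = (\<Sum>j\<in>R. (p j)\<^sup>2)"
    by (rule sum.mono_neutral_right; use R in auto)+
  then have "(sum p UNIV)\<^sup>2 \<le> (\<Sum>j\<in>UNIV. (p j)\<^sup>2) * real (card R)"
    using sum_squared_le_sum_of_squares[of p R] by simp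
  then have "real (card R) * (\<Sum>j\<in>UNIV. \<Sum>l\<in>UNIV - {j}. p j * p l)
      \<le> (real (card R) - 1) * (sum p UNIV)\<^sup>2"
    unfolding eq by (simp add: algebra_simps)
  also have "\<dots> \<le> (real (card R) - 1) * 1"
    using p R(2) by (intro mult_left_mono power_le_one sum_nonneg)
      (auto simp: Suc_le_eq card_gt_0_iff)
  finally show ?thesis by simp
qed

section \<open>The rank bound for design matrices\<close>

theorem design_matrix_rank_ge:
  fixes A :: "complex ^ 'n ^ 'm"
  assumes "design_matrix q k t A" and "0 < t"
  shows "real CARD('n) - (real CARD('n) * real t / real k)\<^sup>2 \<le> rank A"
proof -
  let ?n = "real CARD('n)"
  define I where "I i j \<longleftrightarrow> A $ i $ j \<noteq> 0" for i j
  define c where "c j = real (card {i. I i j})" for j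
  define r where "r i = real (card {j. I i j})" for i
  have k: "0 < k" and c_ge: "real k \<le> c j"
    and t: "j \<noteq> l \<Longrightarrow> card ({i. I i j} \<inter> {i. I i l}) \<le> t" for j l
    using assms(1) by (auto simp: design_matrix_def supp_def column_def c_def I_def)
  have c_pos: "0 < c j" for j
    using c_ge[of j] k by linarith
  define u where "u i j = (if I i j then 1 / c j else 0)" for i j
  define w where "w i = (\<Sum>j\<in>UNIV. u i j)" for i
  have u_nn: "0 \<le> u i j" for i j
    using c_pos[of j] by (simp add: u_def)
  have w_nn: "0 \<le> w i" for i
    by (simp add: w_def sum_nonneg u_nn)
  have u_col: "(\<Sum>i\<in>UNIV. u i j) = 1" for j
    using c_pos[of j] by (simp add: u_def sum.If_cases flip: c_def)
  have w_le: "w i \<le> r i / k" for i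
  proof -
    have "w i = (\<Sum>j | I i j. 1 / c j)"
      by (simp add: w_def u_def sum.If_cases)
    also have "\<dots> \<le> (\<Sum>j | I i j. 1 / real k)"
      using c_ge k by (intro sum_mono divide_left_mono mult_pos_pos c_pos) auto
    finally show ?thesis by (simp add: r_def)
  qed
  \<comment> \<open>The tolerance \<open>t / k\<close> gives the \<open>n\<close> diagonal errors a
    total of \<open>n * (t / k)\<^sup>2\<close>, which together with
    \<open>n * (n - 1) * (t / k)\<^sup>2\<close> off the diagonal makes exactly
    \<open>(n * t / k)\<^sup>2\<close>.\<close>
  obtain x :: "'n \<Rightarrow> real" where x: "\<And>j. 0 < x j" and
    x_bal: "\<And>j. \<bar>(\<Sum>i\<in>UNIV. (\<Sum>l\<in>UNIV. u i l) * ((cmod (A $ i $ j))\<^sup>2 * x j / (\<Sum>l\<in>UNIV. (cmod (A $ i $ l))\<^sup>2 * x l)))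
      - (\<Sum>i\<in>UNIV. u i j)\<bar> \<le> t / k"
    by (rule approximate_scaling[of "\<lambda>i j. (cmod (A $ i $ j))\<^sup>2" u "t / k"])
      (use u_nn k \<open>0 < t\<close> in \<open>auto simp: u_def I_def split: if_splits\<close>)
  define s where "s i = (\<Sum>l\<in>UNIV. (cmod (A $ i $ l))\<^sup>2 * x l)" for i
  define p where "p i j = (cmod (A $ i $ j))\<^sup>2 * x j / s i" for i j
  have s_nn: "0 \<le> s i" for i
    using x by (auto simp: s_def less_imp_le intro!: sum_nonneg)
  have p_nn: "0 \<le> p i j" for i j
    using x s_nn by (simp add: p_def less_imp_le)
  \<comment> \<open>Not an equality: a zero row has \<open>s i = 0\<close> and hence \<open>p i j = 0\<close>.\<close>
  have p_sum: "sum (p i) UNIV \<le> 1" for i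
    by (simp add: p_def sum_divide_distrib[symmetric] s_def)
  have bal: "\<bar>(\<Sum>i\<in>UNIV. w i * p i j) - 1\<bar> \<le> t / k" for j
    using x_bal[of j] by (simp add: u_col w_def p_def s_def)

  \<comment> \<open>\<open>C ** A ** D\<close> is the Gram matrix of the scaling of \<open>A\<close>
    by \<open>sqrt (w i / s i)\<close> on rows and \<open>sqrt (x j)\<close> on columns; both row
    factors sit in \<open>C\<close>. A zero row has \<open>s i = 0\<close> and contributes
    0.\<close>
  define C :: "complex ^ 'm ^ 'n"
    where "C = (\<chi> j i. cnj (A $ i $ j) * of_real (w i / s i * sqrt (x j)))"
  define D :: "complex ^ 'n ^ 'n"
    where "D = (\<chi> j l. if j = l then of_real (sqrt (x j)) else 0)"
  define M where "M = C ** A ** D"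
  have M: "M $ j $ l = (\<Sum>i\<in>UNIV. cnj (A $ i $ j) * A $ i $ l * of_real (w i / s i * sqrt (x j) * sqrt (x l)))" for j l
  proof -
    have "(X ** D) $ j $ l = X $ j $ l * of_real (sqrt (x l))" for X :: "complex ^ 'n ^ 'n"
      by (simp add: D_def matrix_matrix_mult_def if_distrib[of "\<lambda>y. _ * y"] cong: if_cong)
    then have "M $ j $ l = (C ** A) $ j $ l * of_real (sqrt (x l))"
      by (simp only: M_def)
    then show ?thesis
      by (simp add: C_def matrix_matrix_mult_def sum_distrib_left mult_ac)
  qed
  have diag: "(cmod ((M - mat 1) $ j $ j))\<^sup>2 \<le> (t / k)\<^sup>2" for j
  proof -
    have "cnj (A $ i $ j) * A $ i $ j * of_real (w i / s i * sqrt (x j) * sqrt (x j)) = of_real (w i * p i j)" for i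
    proof -
      have "cnj (A $ i $ j) * A $ i $ j = of_real ((cmod (A $ i $ j))\<^sup>2)"
        using complex_norm_square[of "A $ i $ j"] by (simp add: mult.commute)
      then show ?thesis
        using x[of j] by (simp add: p_def mult_ac)
    qed
    then have "M $ j $ j = of_real (\<Sum>i\<in>UNIV. w i * p i j)"
      by (simp add: M)
    then have "(M - mat 1) $ j $ j = of_real ((\<Sum>i\<in>UNIV. w i * p i j) - 1)"
      by (simp add: mat_def)
    then show ?thesis
      using bal[of j] by (metis norm_of_real power_mono norm_ge_zero)
  qed
  \<comment> \<open>The summands have modulus \<open>w i * sqrt (p i j * p i l)\<close> and vanish
    off the common support of the two columns, so Cauchy-Schwarz costs only a factor
    \<open>t\<close>.\<close>
  have off: "(cmod ((M - mat 1) $ j $ l))\<^sup>2 \<le> t * (\<Sum>i\<in>UNIV. (w i)\<^sup>2 * (p i j * p i l))" if "j \<noteq> l" for j l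
  proof -
    let ?T = "{i. I i j} \<inter> {i. I i l}"
    define f where "f i = w i * sqrt (p i j) * sqrt (p i l)" for i
    have f: "cmod (cnj (A $ i $ j) * A $ i $ l * of_real (w i / s i * sqrt (x j) * sqrt (x l))) = f i" for i
    proof -
      have "sqrt (p i j) * sqrt (p i l) = cmod (A $ i $ j) * cmod (A $ i $ l) * (sqrt (x j) * sqrt (x l)) / s i"
        using s_nn[of i] by (simp add: p_def real_sqrt_mult real_sqrt_divide)
      then show ?thesis
        using w_nn[of i] s_nn[of i] x[of j] x[of l] by (simp add: f_def norm_mult norm_divide abs_mult mult.assoc)
    qed
    have "cmod ((M - mat 1) $ j $ l) \<le> (\<Sum>i\<in>UNIV. f i)"
      using that by (simp add: mat_def M) (rule order_trans[OF norm_sum], simp flip: f)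
    also have "\<dots> = (\<Sum>i\<in>?T. f i)"
      by (rule sum.mono_neutral_right) (auto simp: f_def p_def I_def)
    finally have "(cmod ((M - mat 1) $ j $ l))\<^sup>2 \<le> (\<Sum>i\<in>?T. f i)\<^sup>2"
      by (simp add: power_mono)
    also have "\<dots> \<le> (\<Sum>i\<in>?T. (f i)\<^sup>2) * real (card ?T)"
      by (rule sum_squared_le_sum_of_squares)
    also have "\<dots> \<le> (\<Sum>i\<in>UNIV. (f i)\<^sup>2) * t"
      using t[OF that] by (intro mult_mono sum_mono2 sum_nonneg) auto
    also have "(\<Sum>i\<in>UNIV. (f i)\<^sup>2) = (\<Sum>i\<in>UNIV. (w i)\<^sup>2 * (p i j * p i l))"
      using p_nn by (simp add: f_def power_mult_distrib mult.assoc)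
    finally show ?thesis by (simp add: mult.commute)
  qed
  \<comment> \<open>One factor \<open>w i\<close> is traded for \<open>r i / k\<close>, whose
    \<open>r i\<close> is used up by \<open>sum_offdiag_prod_le\<close>. The other is kept for the
    summation over columns.\<close>
  have row: "(w i)\<^sup>2 * (\<Sum>j\<in>UNIV. \<Sum>l\<in>UNIV - {j}. p i j * p i l) \<le> w i * (r i - 1) / k" for i
  proof (cases "\<exists>j. I i j")
    case True
    have "(w i)\<^sup>2 * (\<Sum>j\<in>UNIV. \<Sum>l\<in>UNIV - {j}. p i j * p i l)
        \<le> w i * (r i / k) * (\<Sum>j\<in>UNIV. \<Sum>l\<in>UNIV - {j}. p i j * p i l)"
      unfolding power2_eq_square using w_nn w_le p_nn
      by (intro mult_right_mono mult_left_mono sum_nonneg mult_nonneg_nonneg) auto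
    also have "\<dots> = w i * (r i * (\<Sum>j\<in>UNIV. \<Sum>l\<in>UNIV - {j}. p i j * p i l)) / k"
      by simp
    also have "\<dots> \<le> w i * (r i - 1) / k"
      unfolding r_def using w_nn p_nn p_sum True
      by (intro divide_right_mono mult_left_mono sum_offdiag_prod_le) (auto simp: p_def I_def)
    finally show ?thesis .
  qed (simp add: w_def u_def)
  have "(\<Sum>j\<in>UNIV. \<Sum>l\<in>UNIV - {j}. (cmod ((M - mat 1) $ j $ l))\<^sup>2)
      \<le> (\<Sum>j\<in>UNIV. \<Sum>l\<in>UNIV - {j}. t * (\<Sum>i\<in>UNIV. (w i)\<^sup>2 * (p i j * p i l)))"
    by (intro sum_mono off) auto
  also have "\<dots> = t * (\<Sum>j\<in>UNIV. \<Sum>i\<in>UNIV. \<Sum>l\<in>UNIV - {j}. (w i)\<^sup>2 * (p i j * p i l))"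
    by (simp only: sum_distrib_left[symmetric] sum.swap[of _ UNIV "UNIV - {_}"])
  also have "\<dots> = t * (\<Sum>i\<in>UNIV. (w i)\<^sup>2 * (\<Sum>j\<in>UNIV. \<Sum>l\<in>UNIV - {j}. p i j * p i l))"
    by (subst sum.swap) (simp only: sum_distrib_left)
  also have "\<dots> \<le> t * (\<Sum>i\<in>UNIV. w i * (r i - 1) / k)"
    by (intro mult_left_mono sum_mono row) auto
  \<comment> \<open>Splitting the remaining \<open>w i\<close> into its column weights leaves, for
    each \<open>j\<close>, the average of \<open>r i - 1\<close> over the support of column
    \<open>j\<close>, which the overlap count bounds.\<close>
  also have "(\<Sum>i\<in>UNIV. w i * (r i - 1) / k) = (\<Sum>j\<in>UNIV. (\<Sum>i\<in>UNIV. u i j * (r i - 1))) / k"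
    by (subst sum.swap) (simp add: w_def sum_distrib_right sum_divide_distrib)
  also have "t * \<dots> \<le> t * ((\<Sum>j::'n\<in>UNIV. (?n - 1) * t / k) / k)"
  proof (intro mult_left_mono divide_right_mono sum_mono)
    fix j
    have "(\<Sum>i\<in>UNIV. u i j * (r i - 1)) = (\<Sum>i | I i j. r i - 1) / c j"
      by (simp add: u_def if_distrib[of "\<lambda>x. x * _"] sum.If_cases sum_divide_distrib cong: if_cong)
    also have "\<dots> \<le> (?n - 1) * t / c j"
      unfolding r_def using c_pos[of j]
      by (intro divide_right_mono sum_card_overlap_le) (auto intro!: t)
    also have "\<dots> \<le> (?n - 1) * t / k"
      using c_ge[of j] k c_pos[of j] by (intro divide_left_mono) (auto simp: Suc_le_eq)
    finally show "(\<Sum>i\<in>UNIV. u i j * (r i - 1)) \<le> (?n - 1) * t / k" .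
  qed auto
  also have "\<dots> = ?n * (?n - 1) * (t / k)\<^sup>2"
    by (simp add: power2_eq_square)
  finally have off_sum: "(\<Sum>j\<in>UNIV. \<Sum>l\<in>UNIV - {j}. (cmod ((M - mat 1) $ j $ l))\<^sup>2) \<le> ?n * (?n - 1) * (t / k)\<^sup>2" .
  have diag_sum: "(\<Sum>j\<in>UNIV. (cmod ((M - mat 1) $ j $ j))\<^sup>2) \<le> ?n * (t / k)\<^sup>2"
    using sum_mono[of UNIV, OF diag] by simp
  have "(\<Sum>j\<in>UNIV. \<Sum>l\<in>UNIV. (cmod ((M - mat 1) $ j $ l))\<^sup>2)
      = (\<Sum>j\<in>UNIV. (cmod ((M - mat 1) $ j $ j))\<^sup>2) + (\<Sum>j\<in>UNIV. \<Sum>l\<in>UNIV - {j}. (cmod ((M - mat 1) $ j $ l))\<^sup>2)"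
    unfolding sum.distrib[symmetric] by (intro sum.cong sum.remove) auto
  also have "\<dots> \<le> (?n * t / k)\<^sup>2"
  proof -
    have "?n * (t / k)\<^sup>2 + ?n * (?n - 1) * (t / k)\<^sup>2 = (?n * t / k)\<^sup>2"
      by (simp add: power_mult_distrib power_divide) (simp add: power2_eq_square algebra_simps flip: add_divide_distrib)
    then show ?thesis
      using off_sum diag_sum by linarith
  qed
  finally show ?thesis
    using rank_ge_near_identity[of C A D] unfolding M_def by linarith
qed

theorem corollary1p6:
  fixes A :: "complex ^ 'n ^ 'm" and q k t :: nat
  assumes "design_matrix q k t A"
    and "k \<le> CARD('n) * t"
  shows "real (rank A) \<ge>
    real CARD('n) - 6 * real CARD('n) ^ 3 * real t ^ 3 / real k ^ 3"
proof -
  define z where "z = real CARD('n) * real t / real k"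
  have k: "0 < k" using assms(1) by (simp add: design_matrix_def)
  with assms(2) have "0 < t" by (cases t) auto
  have "real k \<le> real CARD('n) * real t"
    using assms(2) by (metis of_nat_le_iff of_nat_mult)
  then have "1 \<le> z" using k by (simp add: z_def)
  then have "z\<^sup>2 \<le> z ^ 3" by (intro power_increasing) auto
  also have "\<dots> \<le> 6 * z ^ 3" using \<open>1 \<le> z\<close> by simp
  also have "\<dots> = 6 * real CARD('n) ^ 3 * real t ^ 3 / real k ^ 3"
    by (simp add: z_def power_mult_distrib power_divide)
  finally show ?thesis
    using design_matrix_rank_ge[OF assms(1) \<open>0 < t\<close>] unfolding z_def by linarith
qed

end
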